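(* The following two statements hold. (1) Let $n$ be a positive integer with $n>e^{4200}$. Then $$\log p_{n}^{(k)}=k\big(\log k+\log\log k+O_{n}(1)\big)\qquad\text{as } k\rightarrow\infty,$$ where the implied constant may depend on $n$. (2) We have $$\log p_{k}^{(k)}=k\big(\log k+\log\log k+O(\log\log\log k)\big)\qquad\text{as } k\rightarrow\infty.$$
   Context: $p_n$ denotes the $n$th prime number ($p_1=2$, $p_2=3$, ...). For positive integers $n,k$, define $p_n^{(k)}$ recursively by $p_n^{(1)}:=p_n$ and $p_n^{(k)}:=p_{p_n^{(k-1)}}$ for $k\ge 2$; that is, $p_n^{(k)}$ is the $p_n^{(k-1)}$th prime. $\log$ is the natural logarithm. As $k\to\infty$, $O(g(k))$ stands for a function $f(k)$ for which there is a constant $c>0$ with $|f(k)|\le c\,g(k)$ for all sufficiently large $k$; in $O_n(1)$ the constant $c$ (and the threshold for $k$) may depend on $n$. *)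

theory Defs
  imports Complex_Main "HOL-Library.Infinite_Set" "HOL-Library.Landau_Symbols"
    "HOL-Computational_Algebra.Primes"
begin

text \<open>
  Primes are indexed from 1, whereas \<^const>\<open>enumerate\<close> counts from 0; the value at index 0 is
  irrelevant.
\<close>

definition nth_prime :: "nat \<Rightarrow> nat" where
  "nth_prime n = enumerate {p. prime p} (n - 1)"

text \<open>
  \<open>iter_prime n k\<close> is $p_n^{(k)}$. The recursion is started at \<open>k = 0\<close> with the conventional
  value \<open>n\<close>, so that \<open>k = 1\<close> gives $p_n$.
\<close>

primrec iter_prime :: "nat \<Rightarrow> nat \<Rightarrow> nat" where
  "iter_prime n 0 = n"
| "iter_prime n (Suc k) = nth_prime (iter_prime n k)"

lemma iter_prime_1: "iter_prime n 1 = nth_prime n"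
  by simp

lemma iter_prime_rec: "k \<ge> 2 \<Longrightarrow> iter_prime n k = nth_prime (iter_prime n (k - 1))"
  by (cases k) auto

lemma nth_prime_1: "nth_prime 1 = 2"
  by (auto simp: nth_prime_def enumerate_0 prime_ge_2_nat intro!: Least_equality)

lemma range_nth_prime: "nth_prime ` {1..} = {p. prime p}"
proof -
  have "nth_prime ` {1..} = range (enumerate {p::nat. prime p})"
    by (force simp: nth_prime_def image_iff intro: bexI[of _ "Suc _"])
  thus ?thesis
    using range_enumerate[OF primes_infinite] by simp
qed

lemma strict_mono_on_nth_prime: "strict_mono_on {1..} nth_prime"
  by (auto simp: strict_mono_on_def nth_prime_def intro!: enumerate_mono primes_infinite)

end

theory Submission
  imports Defs "HOL-Real_Asymp.Real_Asymp"
begin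

text \<open>
  Chebyshev's bounds give \<open>ln (nth_prime m) = ln m + ln (ln m) + O(1)\<close>, so \<open>x k = ln (iter_prime n k)\<close>
  satisfies \<open>x (k + 1) = x k + ln (x k) + O(1)\<close>. Like the solutions of \<open>x' = ln x\<close>, such a
  sequence grows as \<open>k * (ln k + ln (ln k) + O(1))\<close>. Since \<open>iter_prime n k\<close> is monotone in \<open>n\<close>, a lower
  bound for \<open>n = 1\<close> and an upper bound for \<open>n = k\<close> make the last \<open>O(1)\<close> uniform in
  \<open>1 \<le> n \<le> k\<close>, which covers both statements.
\<close>

section \<open>The increasing enumeration of the primes\<close>

lemma nth_prime_prime: "prime (nth_prime n)"
  using enumerate_in_set[OF primes_infinite] by (simp add: nth_prime_def)

lemma nth_prime_less_iff:
  assumes "m \<ge> 1" "n \<ge> 1"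
  shows "nth_prime m < nth_prime n \<longleftrightarrow> m < n"
  using strict_mono_on_less[OF strict_mono_on_nth_prime] assms by simp

lemma nth_prime_mono: "1 \<le> m \<Longrightarrow> m \<le> n \<Longrightarrow> nth_prime m \<le> nth_prime n"
  using nth_prime_less_iff[of n m] by force

lemma less_nth_prime: "n \<ge> 1 \<Longrightarrow> n < nth_prime n"
proof (induction n rule: nat_induct_at_least)
  case base
  show ?case using nth_prime_1 by simp
next
  case (Suc n)
  then show ?case using nth_prime_less_iff[of n "Suc n"] by simp
qed

lemma primes_le_nth_prime:
  assumes "m \<ge> 1"
  shows "{p. prime p \<and> p \<le> nth_prime m} = nth_prime ` {1..m}"
proof (intro equalityI subsetI)
  fix p assume p: "p \<in> {p. prime p \<and> p \<le> nth_prime m}"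
  then obtain i where "i \<ge> 1" "p = nth_prime i"
    using range_nth_prime by (metis (mono_tags, lifting) atLeast_iff imageE mem_Collect_eq)
  with p assms show "p \<in> nth_prime ` {1..m}"
    using nth_prime_less_iff[of m i] by (auto simp: not_less[symmetric])
qed (use nth_prime_prime nth_prime_mono in auto)

lemma inj_on_nth_prime: "inj_on nth_prime {1..m}"
  using strict_mono_on_imp_inj_on[OF strict_mono_on_nth_prime] by (rule inj_on_subset) auto

lemma card_primes_le_nth_prime:
  "m \<ge> 1 \<Longrightarrow> card {p. prime p \<and> p \<le> nth_prime m} = m"
  using card_image[OF inj_on_nth_prime, of m] by (simp add: primes_le_nth_prime)

section \<open>Lower Chebyshev bound for the nth prime, via primorials\<close>

lemma prod_primes_dvd:
  fixes P :: "nat set"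
  assumes "finite P" "\<And>p. p \<in> P \<Longrightarrow> prime p" "\<And>p. p \<in> P \<Longrightarrow> p dvd n"
  shows "\<Prod>P dvd n"
  using assms
proof (induction P rule: finite_induct)
  case (insert p P)
  have "coprime p (\<Prod>P)"
    using insert by (intro prod_coprime_right) (metis insertCI primes_coprime)
  then show ?case
    using insert by (simp add: divides_mult)
qed auto

lemma prime_dvd_central_binomial:
  fixes p n :: nat
  assumes "prime p" "n < p" "p \<le> 2 * n"
  shows "p dvd (2 * n choose n)"
proof -
  have "p dvd fact n * fact n * (2 * n choose n)"
    using assms binomial_fact_lemma[of n "2 * n"] by (simp add: prime_dvd_fact_iff)
  with assms show ?thesis
    by (simp add: prime_dvd_mult_iff prime_dvd_fact_iff)
qed

text \<open>Induction by halving: with \<open>h\<close> half of \<open>n\<close> rounded up, the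
  primes in \<open>(h, n]\<close> all divide \<open>2 * h choose h\<close>, which is at most
  \<open>4 ^ h\<close>. The base 64 is generous, so that rounding up for odd \<open>n\<close> is
  absorbed by \<open>16 \<le> 4 ^ n\<close> for \<open>n \<ge> 2\<close>.\<close>

lemma primorial_le: "\<Prod>{p::nat. prime p \<and> p \<le> n} \<le> 64 ^ n"
proof (induction n rule: less_induct)
  case (less n)
  show ?case
  proof (cases "n < 2")
    case True
    then have "{p::nat. prime p \<and> p \<le> n} = {}"
      by (auto dest: prime_ge_2_nat)
    then show ?thesis by (simp only: prod.empty) simp
  next
    case False
    define h where "h = (n + 1) div 2"
    have h: "h < n" "n \<le> 2 * h" "2 * h \<le> n + 1"
      using False by (auto simp: h_def)
    let ?A = "{p::nat. prime p \<and> p \<le> h}" and ?B = "{p::nat. prime p \<and> h < p \<and> p \<le> n}"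
    have "\<Prod>{p::nat. prime p \<and> p \<le> n} = \<Prod>(?A \<union> ?B)"
      using h by (intro arg_cong[where f = Prod]) auto
    also have "\<dots> = \<Prod>?A * \<Prod>?B"
      by (intro prod.union_disjoint) auto
    also have "\<Prod>?B \<le> (2 * h choose h)"
    proof (rule dvd_imp_le)
      show "\<Prod>?B dvd (2 * h choose h)"
        using h by (intro prod_primes_dvd) (auto intro: prime_dvd_central_binomial)
    qed simp
    also have "(2 * h choose h) \<le> 2 ^ (2 * h)"
      by (rule binomial_le_pow2)
    also have "\<Prod>?A * 2 ^ (2 * h) \<le> 64 ^ h * 2 ^ (2 * h)"
      using less.IH[OF h(1)] by simp
    also have "\<dots> = (16::nat) ^ (2 * h)"
      by (simp add: power_mult flip: power_mult_distrib)
    also have "\<dots> \<le> 16 ^ (n + 1)"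
      using h by (intro power_increasing) auto
    also have "\<dots> \<le> 64 ^ n"
    proof -
      have "(4::nat) ^ 2 \<le> 4 ^ n"
        using False by (intro power_increasing) auto
      then have "(16::nat) * 16 ^ n \<le> 4 ^ n * 16 ^ n"
        by (intro mult_right_mono) auto
      then show ?thesis by (simp flip: power_mult_distrib)
    qed
    finally show ?thesis by simp
  qed
qed

text \<open>The ith prime exceeds \<open>i\<close>, so the primorial of the mth prime dominates
  \<open>fact m\<close>. Together with Stirling's lower bound this forces the mth prime to be of
  order at least \<open>m * ln m\<close>.\<close>

lemma fact_le_power_nth_prime:
  assumes "m \<ge> 1"
  shows "fact m \<le> (64::nat) ^ nth_prime m"
proof -
  have "fact m = (\<Prod>i\<in>{1..m}. i)"
    by (simp add: fact_prod)
  also have "\<dots> \<le> (\<Prod>i\<in>{1..m}. nth_prime i)"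
    using less_nth_prime by (intro prod_mono) (auto intro: less_imp_le)
  also have "\<dots> = \<Prod>(nth_prime ` {1..m})"
    by (subst prod.reindex[OF inj_on_nth_prime]) simp
  also have "\<dots> = \<Prod>{p. prime p \<and> p \<le> nth_prime m}"
    using assms by (simp only: primes_le_nth_prime)
  also have "\<dots> \<le> 64 ^ nth_prime m"
    by (rule primorial_le)
  finally show ?thesis .
qed

lemma ln_Suc_diff_le:
  assumes "n \<ge> 1"
  shows "ln (real (Suc n)) - ln (real n) \<le> 1 / real n"
proof -
  have "ln (real (Suc n)) - ln (real n) = ln (1 + 1 / real n)"
  proof -
    have "1 + 1 / real n = real (Suc n) / real n"
      using assms by (simp add: field_simps)
    then show ?thesis
      using assms by (simp only: ln_div) (simp add: ln_div)
  qed
  then show ?thesis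
    using ln_add_one_self_le_self[of "1 / real n"] by simp
qed

text \<open>Weak Stirling bound: the left side grows by at most \<open>ln (n + 1)\<close> per step,
  because \<open>n * (ln (n + 1) - ln n) \<le> 1\<close>.\<close>

lemma ln_fact_ge: "n \<ge> 1 \<Longrightarrow> real n * ln (real n) - real n \<le> ln (fact n)"
proof (induction n rule: nat_induct_at_least)
  case (Suc n)
  have "real n * (ln (real (Suc n)) - ln (real n)) \<le> 1"
    using mult_left_mono[OF ln_Suc_diff_le[OF Suc.hyps], of "real n"] Suc.hyps by simp
  moreover have "ln (fact (Suc n) :: real) = ln (real (Suc n)) + ln (fact n)"
    by (simp add: ln_mult del: of_nat_Suc)
  ultimately show ?case
    using Suc.IH by (simp add: algebra_simps)
qed simp

lemma ln_nth_prime_ge: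
  "\<forall>\<^sub>F m in sequentially.
     ln (real m) + ln (ln (real m)) - ln (2 * ln 64) \<le> ln (real (nth_prime m))"
proof -
  have "\<forall>\<^sub>F m in sequentially. ln (real m) \<ge> 2"
    by real_asymp
  then show ?thesis
    using eventually_ge_at_top[of 1]
  proof eventually_elim
    case (elim m)
    have "m > 1"
      using elim by (cases "m = 1") auto
    have "(fact m :: real) \<le> 64 ^ nth_prime m"
      using of_nat_mono[OF fact_le_power_nth_prime[of m], where ?'a = real] elim by simp
    then have "ln (fact m :: real) \<le> ln (64 ^ nth_prime m)"
      by (subst ln_le_cancel_iff) auto
    then have "real m * ln (real m) - real m \<le> real (nth_prime m) * ln 64"
      using ln_fact_ge[of m] elim by (simp add: ln_realpow)
    \<comment> \<open>As \<open>ln m \<ge> 2\<close>, the term \<open>- m\<close> costs at most half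
      of \<open>m * ln m\<close>; this is the factor 2 in \<open>2 * ln 64\<close>.\<close>
    moreover have "2 * real m \<le> real m * ln (real m)"
      using mult_left_mono[OF elim(1), of "real m"] by simp
    ultimately have le: "real m * ln (real m) \<le> real (nth_prime m) * (2 * ln 64)"
      by linarith
    have "ln (real m * ln (real m)) \<le> ln (real (nth_prime m) * (2 * ln 64))"
      using elim le prime_gt_0_nat[OF nth_prime_prime[of m]] \<open>m > 1\<close>
      by (subst ln_le_cancel_iff) (auto intro!: mult_pos_pos)
    then show ?case
      using \<open>m > 1\<close> prime_gt_0_nat[OF nth_prime_prime[of m]] by (simp add: ln_mult)
  qed
qed

section \<open>Upper Chebyshev bound for the nth prime, via common multiples\<close>

text \<open>
  In Leibniz' harmonic triangle the entry \<open>1 / (Suc m * (Suc n choose Suc m))\<close> is the difference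
  of \<open>1 / (m * (n choose m))\<close> and \<open>1 / (m * (Suc n choose m))\<close>, so multiplication by a common
  multiple of \<open>1, \<dots>, N\<close> clears all denominators of the first \<open>N\<close> rows.
\<close>
lemma mult_binomial_dvd_common_multiple:
  fixes D :: nat
  assumes "\<And>i. 1 \<le> i \<Longrightarrow> i \<le> N \<Longrightarrow> i dvd D" and "1 \<le> m" "m \<le> n" "n \<le> N"
  shows "m * (n choose m) dvd D"
  using assms(2-4)
proof (induction m arbitrary: n rule: nat_induct_at_least)
  case base
  then show ?case using assms(1) by simp
next
  case (Suc m)
  then obtain n' where n: "n = Suc n'" and n': "m \<le> n'" "n' \<le> N"
    by (cases n) auto
  define t u where "t = int (n' choose m)" and "u = int (n choose m)"
  have "m * (n' choose m) dvd D" "m * (n choose m) dvd D"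
    using Suc.IH[of n'] Suc.IH[of n] n n' Suc.prems by auto
  then obtain x y where xy: "D = m * (n' choose m) * x" "D = m * (n choose m) * y"
    unfolding dvd_def by blast
  have x: "int D = int m * t * int x"
    using arg_cong[OF xy(1), of int] by (simp only: of_nat_mult t_def)
  have y: "int D = int m * u * int y"
    using arg_cong[OF xy(2), of int] by (simp only: of_nat_mult u_def)
  have "(n - m) * (n choose m) = n * (n' choose m)"
    using binomial_absorb_comp[of n m] n by simp
  then have "int ((n - m) * (n choose m)) = int (n * (n' choose m))"
    by (rule arg_cong)
  then have ut: "(int n - int m) * u = int n * t"
    using Suc_leD[OF Suc.prems(1)] by (simp only: of_nat_mult of_nat_diff t_def u_def)
  have c: "int (Suc m * (n choose Suc m)) = int n * t"
    unfolding n t_def Suc_times_binomial by (rule of_nat_mult)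
  \<comment> \<open>Here \<open>x = D / (m * t)\<close> and \<open>y = D / (m * u)\<close>, so the
    Leibniz difference reads \<open>x - y = D / (n * t)\<close>. It is proved multiplied by the
    nonzero \<open>m * u\<close>, over the integers, to avoid division.\<close>
  have "(int m * u) * (int n * t * (int x - int y)) =
      int n * u * (int m * t * int x) - int n * t * (int m * u * int y)"
    by (simp add: algebra_simps)
  also have "\<dots> = int n * u * int D - int n * t * int D"
    using x y by metis
  also have "\<dots> = (int m * u) * int D"
    unfolding ut[symmetric] by (simp add: algebra_simps)
  finally have "int n * t * (int x - int y) = int D"
    using Suc.hyps n n' by (simp add: u_def)
  then have "int (Suc m * (n choose Suc m)) dvd int D"
    unfolding c by (metis dvd_triv_left)
  then show ?case
    by (simp only: of_nat_dvd_iff)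
qed

text \<open>The witness is the least common multiple of \<open>1, \<dots>, N\<close>. Each of its
  maximal prime powers divides some \<open>i \<le> N\<close>, so every prime up to \<open>N\<close>
  contributes a factor of at most \<open>N\<close>.\<close>

lemma small_common_multiple:
  fixes N :: nat
  obtains D :: nat where "D > 0" "\<And>i. 1 \<le> i \<Longrightarrow> i \<le> N \<Longrightarrow> i dvd D"
    "D \<le> N ^ card {p. prime p \<and> p \<le> N}"
proof -
  define P where "P = {p. prime p \<and> p \<le> N}"
  define e where "e = (\<lambda>p. Max (multiplicity p ` {1..N}))"
  define D where "D = (\<Prod>p\<in>P. p ^ e p)"
  have fin: "finite P" by (simp add: P_def)
  have "D > 0"
    by (auto simp: D_def P_def prime_gt_0_nat intro!: prod_pos)
  moreover have "i dvd D" if "1 \<le> i" "i \<le> N" for i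
  proof -
    have "prime_factors i \<subseteq> P"
      using that by (auto simp: P_def in_prime_factors_iff dest!: dvd_imp_le)
    have "i = (\<Prod>p\<in>prime_factors i. p ^ multiplicity p i)"
      using that prod_prime_factors[of i] by simp
    also have "\<dots> dvd (\<Prod>p\<in>P. p ^ multiplicity p i)"
      using fin \<open>prime_factors i \<subseteq> P\<close> by (rule prod_dvd_prod_subset)
    also have "\<dots> dvd D"
      unfolding D_def e_def using that by (intro prod_dvd_prod le_imp_power_dvd Max_ge) auto
    finally show ?thesis .
  qed
  moreover have "D \<le> N ^ card P"
  proof -
    have "p ^ e p \<le> N" if "p \<in> P" for p
    proof -
      have "N \<ge> 1" using that prime_ge_2_nat[of p] by (auto simp: P_def)
      then have "e p \<in> multiplicity p ` {1..N}"
        unfolding e_def by (intro Max_in) auto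
      then obtain i where "i \<in> {1..N}" "e p = multiplicity p i" by auto
      then show ?thesis
        using dvd_imp_le[OF multiplicity_dvd[of p i]] by auto
    qed
    then have "D \<le> (\<Prod>p\<in>P. N)"
      unfolding D_def by (intro prod_mono) auto
    then show ?thesis by simp
  qed
  ultimately show ?thesis
    using that unfolding P_def by blast
qed

text \<open>Nair's argument: \<open>h * (2 * h choose h)\<close> is at least
  \<open>4 ^ h / 2\<close> and divides the common multiple \<open>D\<close>, while
  \<open>D \<le> N ^ m\<close> because exactly \<open>m\<close> primes are at most \<open>N\<close>.
  The rounding in \<open>h = N div 2\<close> costs another factor 2.\<close>

lemma power_nth_prime_le:
  assumes "m \<ge> 1"
  shows "2 ^ nth_prime m \<le> 4 * nth_prime m ^ m"
proof -
  define N where "N = nth_prime m"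
  define h where "h = N div 2"
  have "N \<ge> 2"
    using nth_prime_prime prime_ge_2_nat by (simp add: N_def)
  then have h: "1 \<le> h" "2 * h \<le> N" "N \<le> 2 * h + 1"
    by (auto simp: h_def)
  obtain D where D: "D > 0" "\<And>i. 1 \<le> i \<Longrightarrow> i \<le> N \<Longrightarrow> i dvd D"
    "D \<le> N ^ card {p. prime p \<and> p \<le> N}"
    using small_common_multiple[of N] by blast
  have "4 ^ h \<le> 2 * (h * (2 * h choose h))"
  proof -
    have "(4::real) ^ h \<le> real (2 * (h * (2 * h choose h)))"
      using central_binomial_lower_bound[of h] h by (simp add: field_simps)
    then show ?thesis
      by (metis of_nat_le_iff of_nat_numeral of_nat_power)
  qed
  also have "h * (2 * h choose h) \<le> D"
    using mult_binomial_dvd_common_multiple[OF D(2) h(1) _ h(2)] D(1) by (intro dvd_imp_le) auto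
  also have "D \<le> N ^ m"
    using D(3) assms by (simp add: N_def card_primes_le_nth_prime)
  finally have "2 ^ (2 * h) \<le> 2 * N ^ m"
    by (simp add: power_mult)
  moreover have "(2::nat) ^ N \<le> 2 ^ (2 * h + 1)"
    using h by (intro power_increasing) auto
  ultimately show ?thesis
    by (simp add: N_def)
qed

lemma ln_le_half: "x > 0 \<Longrightarrow> ln x \<le> x / (2::real)"
  using ln_le_minus_one[of "x / 2"] ln_le_minus_one[of 2] by (simp add: ln_div)

text \<open>Logarithms give \<open>y \<le> ln 6 + ln m + ln y\<close> for \<open>y = ln N\<close>. A
  crude solution \<open>y \<le> 4 * ln m\<close> is put back into \<open>ln y\<close>, whence the
  constant \<open>ln 6 + ln 4 = ln 24\<close>. The assumption \<open>m \<ge> 6\<close> serves to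
  bound \<open>ln 6\<close> by \<open>ln m\<close>.\<close>

lemma ln_nth_prime_le:
  assumes "m \<ge> 6"
  shows "ln (real (nth_prime m)) \<le> ln (real m) + ln (ln (real m)) + ln 24"
proof -
  define N y where "N = nth_prime m" and "y = ln (real N)"
  have N: "N \<ge> 2"
    using nth_prime_prime prime_ge_2_nat by (simp add: N_def)
  have y: "y > 0" using N by (simp add: y_def)
  have m: "ln (real m) > 0" using assms by simp
  have "real (2 ^ N) \<le> real (4 * N ^ m)"
    using power_nth_prime_le[of m] assms by (subst of_nat_le_iff) (simp add: N_def)
  then have "(2::real) ^ N \<le> 2 ^ 2 * real N ^ m"
    by simp
  then have "ln ((2::real) ^ N) \<le> ln (2 ^ 2 * real N ^ m)"
    using N by (subst ln_le_cancel_iff) auto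
  then have *: "real N * ln 2 \<le> 2 * ln 2 + real m * y"
    using N by (simp only: ln_mult ln_realpow y_def) (simp add: ln_mult ln_realpow)
  \<comment> \<open>Origin of the 6: \<open>2 * ln 2 \<le> 2 * m * y\<close> makes the right side of
    \<open>*\<close> at most \<open>3 * m * y\<close>, and \<open>ln 2 \<ge> 1/2\<close>.\<close>
  have "ln 2 \<le> y" using N by (simp add: y_def)
  moreover have "2 * y \<le> 2 * real m * y"
    using assms y by (intro mult_right_mono) auto
  moreover have "real N * (1/2) \<le> real N * ln 2"
    using ln_le_minus_one[of "1/2"] by (intro mult_left_mono) (auto simp: ln_div)
  ultimately have "real N \<le> 6 * real m * y"
    using * by linarith
  then have "ln (real N) \<le> ln (6 * real m * y)"
    using N assms y by (subst ln_le_cancel_iff) auto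
  then have 1: "y \<le> ln 6 + ln (real m) + ln y"
    using assms y by (simp add: ln_mult y_def)
  have "ln 6 \<le> ln (real m)" using assms by simp
  then have "y \<le> 4 * ln (real m)"
    using 1 ln_le_half[OF y] by linarith
  then have "ln y \<le> ln (4 * ln (real m))"
    using y m by (subst ln_le_cancel_iff) auto
  also have "\<dots> = ln 4 + ln (ln (real m))"
    using m by (simp add: ln_mult)
  finally have "y \<le> ln (real m) + ln (ln (real m)) + (ln 6 + ln 4)"
    using 1 by linarith
  also have "ln 6 + ln 4 = ln (24::real)"
    using ln_mult[of 6 "4::real"] by simp
  finally show ?thesis by (simp add: y_def N_def)
qed

section \<open>Growth of sequences with logarithmic increments\<close>

text \<open>Comparison of increments from a threshold \<open>J\<close> on; \<open>B\<close> absorbs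
  the difference of the values at \<open>J\<close>.\<close>

lemma eventually_telescope_ge:
  fixes x f :: "nat \<Rightarrow> real"
  assumes "\<forall>\<^sub>F j in sequentially. f (Suc j) - f j \<le> x (Suc j) - x j"
  obtains B where "\<forall>\<^sub>F j in sequentially. f j - B \<le> x j"
proof -
  obtain J where J: "\<And>j. j \<ge> J \<Longrightarrow> f (Suc j) - f j \<le> x (Suc j) - x j"
    using assms by (auto simp: eventually_sequentially)
  have "f j - (f J - x J) \<le> x j" if "j \<ge> J" for j
    using that by (induction j rule: dec_induct) (use J in force)+
  then show ?thesis
    using that[of "f J - x J"] by (auto simp: eventually_sequentially)
qed

text \<open>
  A solution of \<open>x' \<ge> ln x - C\<close> is bootstrapped from \<open>x j \<ge> j / 2\<close> through \<open>x j \<ge> j * ln j / 2\<close>.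
\<close>
lemma log_recurrence_lower:
  fixes x :: "nat \<Rightarrow> real"
  assumes rec: "\<forall>\<^sub>F j in sequentially. x j + ln (x j) - C \<le> x (Suc j)"
    and top: "filterlim x at_top sequentially"
  obtains A where
    "\<forall>\<^sub>F j in sequentially. real j * (ln (real j) + ln (ln (real j)) - A) \<le> x j"
proof -
  \<comment> \<open>One round of the bootstrap: a lower bound \<open>g\<close> for \<open>x\<close>
    bounds the increments of \<open>x\<close> by \<open>ln (g j) - C\<close>, and \<open>f\<close>
    is a minorant of their sum.\<close>
  have boot: thesis' if lower: "\<forall>\<^sub>F j in sequentially. g j \<le> x j"
    and pos: "\<forall>\<^sub>F j in sequentially. 0 < g j"
    and step: "\<forall>\<^sub>F j in sequentially. f (Suc j) - f j \<le> ln (g j) - C"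
    and res: "\<And>B. \<forall>\<^sub>F j in sequentially. f j - B \<le> x j \<Longrightarrow> thesis'"
    for f g :: "nat \<Rightarrow> real" and thesis'
  proof -
    have "\<forall>\<^sub>F j in sequentially. f (Suc j) - f j \<le> x (Suc j) - x j"
      using rec lower pos step
    proof eventually_elim
      case (elim j)
      have "ln (g j) \<le> ln (x j)"
        using elim by (subst ln_le_cancel_iff) auto
      then show ?case using elim by linarith
    qed
    then show ?thesis
      using eventually_telescope_ge res by blast
  qed
  \<comment> \<open>The constant \<open>exp (C + 1)\<close> makes every late increment at least 1,
    which starts the bootstrap with linear growth.\<close>
  have "\<forall>\<^sub>F j in sequentially. exp (C + 1) \<le> x j"
    using top by (simp add: filterlim_at_top)
  then obtain B1 where B1: "\<forall>\<^sub>F j in sequentially. real j - B1 \<le> x j"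
    by (rule boot[where f = real]) auto
  have "\<forall>\<^sub>F j in sequentially. real j / 2 \<le> real j - B1"
    by real_asymp
  with B1 have "\<forall>\<^sub>F j in sequentially. real j / 2 \<le> x j"
    by eventually_elim linarith
  \<comment> \<open>The increment of \<open>j * ln j\<close> is eventually at most
    \<open>ln j + 2\<close>, and halving the argument of the logarithm loses
    \<open>ln 2 \<le> 1\<close>: together the 3 in \<open>C + 3\<close>. The next round has the same
    losses.\<close>
  then obtain B2 where B2:
    "\<forall>\<^sub>F j in sequentially. real j * ln (real j) - (C + 3) * real j - B2 \<le> x j"
  proof (rule boot[where f = "\<lambda>j. real j * ln (real j) - (C + 3) * real j"])
    show "\<forall>\<^sub>F j in sequentially. 0 < real j / 2"
      by real_asymp
    show "\<forall>\<^sub>F j in sequentially. real (Suc j) * ln (real (Suc j)) - (C + 3) * real (Suc j)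
        - (real j * ln (real j) - (C + 3) * real j) \<le> ln (real j / 2) - C"
    proof -
      have "\<forall>\<^sub>F j in sequentially.
          (real j + 1) * ln (real j + 1) - real j * ln (real j) - ln (real j) \<le> 2"
        by real_asymp
      then show ?thesis
        using eventually_gt_at_top[of 0]
      proof eventually_elim
        case (elim j)
        then show ?case
          using ln_le_minus_one[of "2::real"] by (simp add: ln_div add.commute algebra_simps)
      qed
    qed
  qed
  have "\<forall>\<^sub>F j in sequentially. real j * ln (real j) / 2 \<le> real j * ln (real j) - (C + 3) * real j - B2"
    by real_asymp
  with B2 have "\<forall>\<^sub>F j in sequentially. real j * ln (real j) / 2 \<le> x j"
    by eventually_elim linarith
  then obtain B3 where B3: "\<forall>\<^sub>F j in sequentially.
      real j * (ln (real j) + ln (ln (real j))) - (C + 3) * real j - B3 \<le> x j"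
  proof (rule boot[where f = "\<lambda>j. real j * (ln (real j) + ln (ln (real j))) - (C + 3) * real j"])
    show "\<forall>\<^sub>F j in sequentially. 0 < real j * ln (real j) / 2"
      by real_asymp
    show "\<forall>\<^sub>F j in sequentially.
        real (Suc j) * (ln (real (Suc j)) + ln (ln (real (Suc j)))) - (C + 3) * real (Suc j)
        - (real j * (ln (real j) + ln (ln (real j))) - (C + 3) * real j)
          \<le> ln (real j * ln (real j) / 2) - C"
    proof -
      have "\<forall>\<^sub>F j in sequentially. (real j + 1) * (ln (real j + 1) + ln (ln (real j + 1)))
          - real j * (ln (real j) + ln (ln (real j))) - (ln (real j) + ln (ln (real j))) \<le> 2"
        by real_asymp
      then show ?thesis
        using eventually_gt_at_top[of 1]
      proof eventually_elim
        case (elim j)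
        then show ?case
          using ln_le_minus_one[of "2::real"]
          by (simp add: ln_div ln_mult add.commute algebra_simps)
      qed
    qed
  qed
  \<comment> \<open>The additive constant is absorbed by one more \<open>j\<close>, turning
    \<open>C + 3\<close> into \<open>C + 4\<close>.\<close>
  have "\<forall>\<^sub>F j in sequentially. B3 \<le> real j"
    by real_asymp
  with B3 have "\<forall>\<^sub>F j in sequentially. real j * (ln (real j) + ln (ln (real j)) - (C + 4)) \<le> x j"
    by eventually_elim (simp add: algebra_simps)
  then show ?thesis by (rule that)
qed

section \<open>Two-sided bounds for iterated primes\<close>

lemma iter_prime_ge: "n \<ge> 1 \<Longrightarrow> n + k \<le> iter_prime n k"
proof (induction k)
  case (Suc k)
  then show ?case using less_nth_prime[of "iter_prime n k"] by simp
qed simp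

lemma iter_prime_mono: "1 \<le> m \<Longrightarrow> m \<le> n \<Longrightarrow> iter_prime m k \<le> iter_prime n k"
proof (induction k)
  case (Suc k)
  then show ?case using iter_prime_ge[of m k] by (auto intro!: nth_prime_mono)
qed simp

lemma ln_iter_prime_lower:
  obtains A where "\<forall>\<^sub>F k in sequentially. \<forall>n\<ge>1.
    real k * (ln (real k) + ln (ln (real k)) - A) \<le> ln (real (iter_prime n k))"
proof -
  have lim: "filterlim (iter_prime 1) at_top sequentially"
    using iter_prime_ge[of 1]
    by (intro filterlim_at_top_mono[OF filterlim_ident])
       (auto intro!: always_eventually intro: order_trans[rotated] simp: Suc_leD)
  define x where "x = (\<lambda>k. ln (real (iter_prime 1 k)))"
  \<comment> \<open>The bound valid for all large \<open>m\<close> is pulled back along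
    \<open>m = iter_prime 1 k\<close>, which tends to infinity.\<close>
  have "\<forall>\<^sub>F k in sequentially. x k + ln (x k) - ln (2 * ln 64) \<le> x (Suc k)"
    using filterlim_iff[THEN iffD1, OF lim, rule_format, OF ln_nth_prime_ge]
    by (simp add: x_def)
  moreover have "filterlim x at_top sequentially"
    unfolding x_def
    by (intro filterlim_compose[OF ln_at_top] filterlim_compose[OF filterlim_real_sequentially] lim)
  ultimately obtain A where A:
    "\<forall>\<^sub>F k in sequentially. real k * (ln (real k) + ln (ln (real k)) - A) \<le> x k"
    by (rule log_recurrence_lower)
  have "x k \<le> ln (real (iter_prime n k))" if "n \<ge> 1" for n k
    using iter_prime_ge[of 1 k] iter_prime_mono[of 1 n k] that
    by (simp add: x_def)
  then have "\<forall>\<^sub>F k in sequentially. \<forall>n\<ge>1.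
    real k * (ln (real k) + ln (ln (real k)) - A) \<le> ln (real (iter_prime n k))"
    using A by (auto elim!: eventually_mono intro: order_trans)
  then show ?thesis by (rule that)
qed

text \<open>
  The crude bound \<open>ln (iter_prime k j) \<le> 4 * k * ln k\<close> for \<open>j \<le> k\<close> bounds every increment of
  \<open>ln (iter_prime k j)\<close> by \<open>ln (4 * k * ln k) + ln 24\<close>, which in turn preserves the crude bound.
\<close>
lemma ln_iter_prime_upper:
  obtains A where "\<forall>\<^sub>F k in sequentially.
    ln (real (iter_prime k k)) \<le> real k * (ln (real k) + ln (ln (real k)) + A)"
proof -
  \<comment> \<open>\<open>ln 4\<close> stems from the crude bound \<open>4 * k * ln k\<close>,
    \<open>ln 24\<close> from the bound for a single prime.\<close>
  define A :: real where "A = ln 4 + ln 24"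
  have ev: "\<forall>\<^sub>F k in sequentially. ln (real k) + real k * (ln (real k) + ln (ln (real k)) + A)
      \<le> 4 * real k * ln (real k)"
    unfolding A_def by real_asymp
  have ev': "\<forall>\<^sub>F k in sequentially. 1 \<le> ln (real k) \<and> 1 \<le> ln (ln (real k))"
    by (intro eventually_conj; real_asymp)
  have "\<forall>\<^sub>F k in sequentially.
      ln (real (iter_prime k k)) \<le> real k * (ln (real k) + ln (ln (real k)) + (A + 1))"
    using ev ev' eventually_ge_at_top[of 6]
  proof eventually_elim
    case (elim k)
    define L where "L = ln (real k) + ln (ln (real k)) + A"
    have "L \<ge> 0" using elim by (simp add: L_def A_def)
    \<comment> \<open>The slope \<open>L\<close> depends on \<open>k\<close> only, so the induction
      on \<open>j\<close> is linear; \<open>j \<le> k\<close> keeps the right side below the crude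
      bound.\<close>
    have "ln (real (iter_prime k j)) \<le> ln (real k) + real j * L" if "j \<le> k" for j
      using that
    proof (induction j)
      case (Suc j)
      define m where "m = iter_prime k j"
      have m: "m \<ge> 6"
        using iter_prime_ge[of k j] elim by (simp add: m_def)
      have IH: "ln (real m) \<le> ln (real k) + real j * L"
        using Suc by (simp add: m_def)
      also have "\<dots> \<le> ln (real k) + real k * L"
        using Suc.prems \<open>L \<ge> 0\<close> by (intro add_left_mono mult_right_mono) auto
      also have "\<dots> \<le> 4 * real k * ln (real k)"
        using elim by (simp add: L_def)
      finally have "ln (ln (real m)) \<le> ln (4 * real k * ln (real k))"
        using elim m by (subst ln_le_cancel_iff) auto
      also have "\<dots> = L - ln 24"
        using elim by (simp add: ln_mult L_def A_def)
      finally have "ln (real (nth_prime m)) \<le> ln (real m) + L"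
        using ln_nth_prime_le[OF m] by simp
      then show ?case
        using IH by (simp add: m_def algebra_simps)
    qed simp
    from this[of k] have "ln (real (iter_prime k k)) \<le> ln (real k) + real k * L"
      by simp
    \<comment> \<open>The starting value \<open>ln k\<close> is paid for by the 1 in
      \<open>A + 1\<close>.\<close>
    also have "ln (real k) \<le> real k"
      using elim ln_le_minus_one[of "real k"] by simp
    finally show ?case
      by (simp add: L_def algebra_simps)
  qed
  then show ?thesis by (rule that)
qed

section \<open>The error term and both asymptotic statements\<close>

text \<open>The asserted equation solved for its error term: it then holds exactly for
  \<open>k > 0\<close>, and only the size of the error is left to estimate.\<close>

definition iter_prime_error :: "nat \<Rightarrow> nat \<Rightarrow> real" where
  "iter_prime_error n k = ln (real (iter_prime n k)) / real k - ln (real k) - ln (ln (real k))"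

lemma ln_iter_prime_eq:
  "k > 0 \<Longrightarrow> ln (real (iter_prime n k)) =
    real k * (ln (real k) + ln (ln (real k)) + iter_prime_error n k)"
  by (simp add: iter_prime_error_def)

lemma iter_prime_error_bounded:
  obtains A where "\<forall>\<^sub>F k in sequentially. \<forall>n\<in>{1..k}. \<bar>iter_prime_error n k\<bar> \<le> A"
proof -
  obtain A where A: "\<forall>\<^sub>F k in sequentially. \<forall>n\<ge>1.
    real k * (ln (real k) + ln (ln (real k)) - A) \<le> ln (real (iter_prime n k))"
    by (rule ln_iter_prime_lower)
  obtain A' where A': "\<forall>\<^sub>F k in sequentially.
    ln (real (iter_prime k k)) \<le> real k * (ln (real k) + ln (ln (real k)) + A')"
    by (rule ln_iter_prime_upper)
  have "\<forall>\<^sub>F k in sequentially. \<forall>n\<in>{1..k}. \<bar>iter_prime_error n k\<bar> \<le> max A A'"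
    using A A' eventually_gt_at_top[of 0]
  proof eventually_elim
    case (elim k)
    show ?case
    proof
      fix n assume n: "n \<in> {1..k}"
      have "ln (real (iter_prime n k)) \<le> ln (real (iter_prime k k))"
        using n iter_prime_mono[of n k k] iter_prime_ge[of n k] by simp
      with elim n have "real k * (ln (real k) + ln (ln (real k)) - A)
            \<le> real k * (ln (real k) + ln (ln (real k)) + iter_prime_error n k)"
          "real k * (ln (real k) + ln (ln (real k)) + iter_prime_error n k)
            \<le> real k * (ln (real k) + ln (ln (real k)) + A')"
        unfolding ln_iter_prime_eq[OF elim(3), symmetric] by auto
      then show "\<bar>iter_prime_error n k\<bar> \<le> max A A'"
        using elim(3) by (auto simp: mult_le_cancel_left_pos)
    qed
  qed
  then show ?thesis by (rule that)
qed

theorem theorem3p1: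
  shows "(\<forall>n::nat. n \<ge> 1 \<and> real n > exp 4200 \<longrightarrow>
           (\<exists>E :: nat \<Rightarrow> real. E \<in> O[at_top](\<lambda>k. 1) \<and>
             (\<forall>\<^sub>F k in at_top. ln (real (iter_prime n k)) =
                real k * (ln (real k) + ln (ln (real k)) + E k)))) \<and>
         (\<exists>E :: nat \<Rightarrow> real. E \<in> O[at_top](\<lambda>k. ln (ln (ln (real k)))) \<and>
           (\<forall>\<^sub>F k in at_top. ln (real (iter_prime k k)) =
              real k * (ln (real k) + ln (ln (real k)) + E k)))"
proof (intro conjI allI impI)
  obtain A where A: "\<forall>\<^sub>F k in sequentially. \<forall>n\<in>{1..k}. \<bar>iter_prime_error n k\<bar> \<le> A"
    by (rule iter_prime_error_bounded)
  \<comment> \<open>The starting index is a function \<open>f\<close> of \<open>k\<close>: constant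
    for the first statement, the identity for the second.\<close>
  have eq: "\<forall>\<^sub>F k in sequentially. ln (real (iter_prime (f k) k)) =
      real k * (ln (real k) + ln (ln (real k)) + iter_prime_error (f k) k)" for f
    using eventually_gt_at_top[of 0] by eventually_elim (rule ln_iter_prime_eq)
  have bigo: "(\<lambda>k. iter_prime_error (f k) k) \<in> O(\<lambda>k. 1)"
    if "\<forall>\<^sub>F k in sequentially. f k \<in> {1..k}" for f
  proof (rule bigoI[of _ A])
    show "\<forall>\<^sub>F k in sequentially. norm (iter_prime_error (f k) k) \<le> A * norm (1::real)"
      using A that by eventually_elim auto
  qed
  {
    fix n :: nat assume "n \<ge> 1 \<and> real n > exp 4200"
    then have "\<forall>\<^sub>F k in sequentially. n \<in> {1..k}"
      using eventually_ge_at_top[of n] by simp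
    then show "\<exists>E :: nat \<Rightarrow> real. E \<in> O[at_top](\<lambda>k. 1) \<and>
        (\<forall>\<^sub>F k in at_top. ln (real (iter_prime n k)) =
          real k * (ln (real k) + ln (ln (real k)) + E k))"
      using bigo[of "\<lambda>_. n"] eq[of "\<lambda>_. n"] by blast
  }
  have "\<forall>\<^sub>F k::nat in sequentially. k \<in> {1..k}"
    using eventually_ge_at_top[of 1] by simp
  then have "(\<lambda>k. iter_prime_error k k) \<in> O(\<lambda>k. 1)"
    by (rule bigo)
  \<comment> \<open>A bounded error is admissible since the triple logarithm tends to
    infinity.\<close>
  also have "(\<lambda>k::nat. 1::real) \<in> O(\<lambda>k. ln (ln (ln (real k))))"
    by real_asymp
  finally show "\<exists>E :: nat \<Rightarrow> real. E \<in> O[at_top](\<lambda>k. ln (ln (ln (real k)))) \<and>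
      (\<forall>\<^sub>F k in at_top. ln (real (iter_prime k k)) =
        real k * (ln (real k) + ln (ln (real k)) + E k))"
    using eq[of "\<lambda>k. k"] by blast
qed

end
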